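(* Let $(Q,\ell,\sigma)$ be a symbolic dynamical system and let $(X,d,f)$ be a discrete dynamical system such that $(X,d)$ is a continuum. Then $(Q,\ell,\sigma)$ and $(X,d,f)$ are not topologically conjugate.
   Context: A discrete dynamical system $(X,d,f)$ consists of a set $X$, a metric $d$ on $X$, and a function $f:X\to X$ (not assumed continuous). A continuum is a compact, connected metric space with uncountably many elements. A qualitative dynamical system $(Q,\ell,\sigma)$ consists of a set $Q$ of infinite (one-sided) sequences of symbols from a finite set $\Sigma$, i.e. $Q\subseteq\Sigma^{\mathbb N}$; a metric $\ell$ on $Q$ whose metric topology equals the topology on $Q$ inherited from the product topology of $\Sigma^{\mathbb N}$ ($\Sigma$ discrete), so that the cylinder sets (all elements of $Q$ sharing a given finite prefix) form a basis; and the shift map $\sigma:Q\to Q$, which deletes the first symbol of a sequence. It is a symbolic dynamical system (subshift) if and only if, in addition, $(Q,\ell)$ is compact and $\sigma(Q)=Q$. Two discrete dynamical systems $(X_1,d_1,f_1)$ and $(X_2,d_2,f_2)$ are topologically conjugate if and only if there exists a homeomorphism $h:X_1\to X_2$ (for the metric topologies) with $h\circ f_1=f_2\circ h$. *)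

theory Defs
  imports "HOL-Analysis.Analysis"
begin

definition discrete_dynamical_system ::
    "'a set \<Rightarrow> ('a \<Rightarrow> 'a \<Rightarrow> real) \<Rightarrow> ('a \<Rightarrow> 'a) \<Rightarrow> bool" where
  "discrete_dynamical_system X d f \<longleftrightarrow> Metric_space X d \<and> f \<in> X \<rightarrow> X"

definition continuum :: "'a set \<Rightarrow> ('a \<Rightarrow> 'a \<Rightarrow> real) \<Rightarrow> bool" where
  "continuum X d \<longleftrightarrow>
     Metric_space X d \<and>
     compact_space (Metric_space.mtopology X d) \<and>
     connected_space (Metric_space.mtopology X d) \<and>
     uncountable X"

definition shift :: "(nat \<Rightarrow> 'a) \<Rightarrow> (nat \<Rightarrow> 'a)" where
  "shift s = (\<lambda>n. s (Suc n))"

definition full_shift_topology :: "'a set \<Rightarrow> (nat \<Rightarrow> 'a) topology" where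
  "full_shift_topology \<Sigma> = product_topology (\<lambda>_. discrete_topology \<Sigma>) UNIV"

text \<open>The map of a qualitative or symbolic dynamical system is always \<^const>\<open>shift\<close>,
  so only the alphabet, the set of sequences and the metric are arguments.\<close>

definition qualitative_dynamical_system ::
    "'a set \<Rightarrow> (nat \<Rightarrow> 'a) set \<Rightarrow> ((nat \<Rightarrow> 'a) \<Rightarrow> (nat \<Rightarrow> 'a) \<Rightarrow> real) \<Rightarrow> bool" where
  "qualitative_dynamical_system \<Sigma> Q l \<longleftrightarrow>
     finite \<Sigma> \<and>
     Q \<subseteq> UNIV \<rightarrow> \<Sigma> \<and>
     discrete_dynamical_system Q l shift \<and>
     Metric_space.mtopology Q l = subtopology (full_shift_topology \<Sigma>) Q"

definition symbolic_dynamical_system ::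
    "'a set \<Rightarrow> (nat \<Rightarrow> 'a) set \<Rightarrow> ((nat \<Rightarrow> 'a) \<Rightarrow> (nat \<Rightarrow> 'a) \<Rightarrow> real) \<Rightarrow> bool" where
  "symbolic_dynamical_system \<Sigma> Q l \<longleftrightarrow>
     qualitative_dynamical_system \<Sigma> Q l \<and>
     compact_space (Metric_space.mtopology Q l) \<and>
     shift ` Q = Q"

definition topologically_conjugate ::
    "'a set \<Rightarrow> ('a \<Rightarrow> 'a \<Rightarrow> real) \<Rightarrow> ('a \<Rightarrow> 'a) \<Rightarrow>
     'b set \<Rightarrow> ('b \<Rightarrow> 'b \<Rightarrow> real) \<Rightarrow> ('b \<Rightarrow> 'b) \<Rightarrow> bool" where
  "topologically_conjugate X\<^sub>1 d\<^sub>1 f\<^sub>1 X\<^sub>2 d\<^sub>2 f\<^sub>2 \<longleftrightarrow>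
     (\<exists>h. homeomorphic_map (Metric_space.mtopology X\<^sub>1 d\<^sub>1) (Metric_space.mtopology X\<^sub>2 d\<^sub>2) h \<and>
          (\<forall>x\<in>X\<^sub>1. h (f\<^sub>1 x) = f\<^sub>2 (h x)))"

end

theory Submission
  imports Defs
begin

text \<open>Sequence spaces over a discrete alphabet are totally disconnected
  (\<open>connectedin_product_discrete_topology_eq\<close>), while connectedness is a homeomorphism
  invariant. A subshift conjugate to a continuum would therefore be connected, hence have at most
  one point, and could not be in bijection with an uncountable set.\<close>

text \<open>Coordinate projections are continuous, and a connected subset of a discrete space has at
  most one point; so two points of \<open>S\<close> agree in every coordinate.\<close>

lemma connectedin_product_discrete_topology_eq:
  fixes S :: "('i \<Rightarrow> 'a) set"
  assumes "connectedin (product_topology (\<lambda>_. discrete_topology \<Sigma>) UNIV) S" "x \<in> S" "y \<in> S"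
  shows "x = y"
proof (rule ext)
  fix n :: 'i
  have "continuous_map (product_topology (\<lambda>_. discrete_topology \<Sigma>) UNIV) (discrete_topology \<Sigma>) (\<lambda>s. s n)"
    by (rule continuous_map_product_projection) simp
  then have "connectedin (discrete_topology \<Sigma>) ((\<lambda>s. s n) ` S)"
    using assms(1) by (rule connectedin_continuous_map_image)
  then show "x n = y n"
    using assms(2,3) by (auto simp: connectedin_discrete_topology)
qed

theorem lemma1:
  fixes \<Sigma> :: "'a set"
    and Q :: "(nat \<Rightarrow> 'a) set"
    and l :: "(nat \<Rightarrow> 'a) \<Rightarrow> (nat \<Rightarrow> 'a) \<Rightarrow> real"
    and X :: "'b set"
    and d :: "'b \<Rightarrow> 'b \<Rightarrow> real"
    and f :: "'b \<Rightarrow> 'b"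
  assumes "symbolic_dynamical_system \<Sigma> Q l"
    and "discrete_dynamical_system X d f"
    and "continuum X d"
  shows "\<not> topologically_conjugate Q l shift X d f"
proof
  assume "topologically_conjugate Q l shift X d f"
  then obtain h
    where h: "homeomorphic_map (Metric_space.mtopology Q l) (Metric_space.mtopology X d) h"
    by (auto simp: topologically_conjugate_def)
  have Q: "Q \<subseteq> UNIV \<rightarrow> \<Sigma>" "Metric_space Q l"
    "Metric_space.mtopology Q l = subtopology (full_shift_topology \<Sigma>) Q"
    using assms(1)
    by (auto simp: symbolic_dynamical_system_def qualitative_dynamical_system_def
        discrete_dynamical_system_def)
  have X: "Metric_space X d" "connected_space (Metric_space.mtopology X d)" "uncountable X"
    using assms(3) by (auto simp: continuum_def)
  have "connected_space (Metric_space.mtopology Q l)"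
    using homeomorphic_connected_space[OF homeomorphic_map_imp_homeomorphic_space[OF h]] X(2) by simp
  \<comment> \<open>Since the metric topology of \<open>Q\<close> is the subspace topology,
    connectedness of the space \<open>Q\<close> is connectedness of \<open>Q\<close> as a subset of
    the product.\<close>
  then have "connectedin (product_topology (\<lambda>_. discrete_topology \<Sigma>) UNIV) Q"
    using Q(1) by (auto simp: Q(3) connectedin_def full_shift_topology_def)
  \<comment> \<open>The choice term names the only possible point without a case split: for empty
    \<open>Q\<close> the inclusion is trivial.\<close>
  then have "Q \<subseteq> {SOME x. x \<in> Q}"
    using connectedin_product_discrete_topology_eq by (metis singletonI someI subsetI)
  then have "countable (h ` Q)"
    by (meson countable_finite countable_image finite.emptyI finite_insert finite_subset)
  moreover have "h ` Q = X"
    using homeomorphic_imp_surjective_map[OF h]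
    by (simp add: Metric_space.topspace_mtopology Q(2) X(1))
  ultimately show False
    using X(3) by simp
qed

end
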